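(* Suppose $B\in\mathbb{R}^{m\times m}$ is invertible and $B=TW$ with $T=T^T\in\mathbb{R}^{m\times m}$ and $W=W^T\in\mathbb{R}^{m\times m}$. Let $(p,n,0)$ be the inertia of $T$. If $B$ has $m-s$ non-real eigenvalues (thus $\frac{1}{2}m-\frac{1}{2}s$ complex conjugate pairs), then $$\frac{1}{2}m-\frac{1}{2}s \leq p \leq \frac{1}{2}m+\frac{1}{2}s .$$
   Context: The inertia of a real symmetric matrix is the triple $(p,n,z)$, where $p$, $n$ and $z$ are respectively the numbers of positive, negative and zero eigenvalues, counted with multiplicity. Since $B=TW$ is invertible, $T$ is invertible and has no zero eigenvalues. "Non-real" refers to complex numbers with non-vanishing imaginary part. Eigenvalues of $B$ are counted with algebraic multiplicity, so $B$ has $m$ eigenvalues in total in $\mathbb{C}$, exactly $m-s$ of them non-real and exactly $s$ of them real. *)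

theory Defs
  imports "Jordan_Normal_Form.Char_Poly"
begin

text \<open>The number of eigenvalues of \<open>A\<close> in its base field that satisfy \<open>P\<close>, counted with algebraic
  multiplicity. For a matrix with entries in a field the index set is finite, being contained in
  the set of roots of the monic polynomial \<open>char_poly A\<close>.\<close>

definition eigenvalue_count :: "('a :: field \<Rightarrow> bool) \<Rightarrow> 'a mat \<Rightarrow> nat" where
  "eigenvalue_count P A = (\<Sum>a | eigenvalue A a \<and> P a. Polynomial.order a (char_poly A))"

text \<open>Meant for symmetric matrices: all their complex eigenvalues are real and the algebraic and
  geometric multiplicities agree, so counting the eigenvalues in the base field loses nothing.\<close>

definition inertia :: "real mat \<Rightarrow> nat \<times> nat \<times> nat" where
  "inertia T =
     (eigenvalue_count (\<lambda>x. x > 0) T, eigenvalue_count (\<lambda>x. x < 0) T, eigenvalue_count (\<lambda>x. x = 0) T)"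

end

theory Submission
  imports Defs "Jordan_Normal_Form.Schur_Decomposition"
begin

text \<open>Put \<open>C = W T = B\<^sup>T\<close>, so that \<open>T C\<close> is symmetric. Triangularize \<open>C\<close> over the complex numbers with the
  eigenvalues of positive (or of negative) imaginary part first; the invariant subspace spanned by
  the corresponding leading columns is isotropic for the Hermitian form \<open>x\<^sup>* T x\<close>, since no
  two of these eigenvalues are conjugate. An isotropic subspace meets the spans of the eigenvectors of
  \<open>T\<close> with positive and with negative eigenvalues only in 0, hence its dimension is at most
  \<open>m - p\<close> and at most \<open>p\<close>. Adding the bounds for the two half planes gives the claim.\<close>

section \<open>Conjugate transposes and triangular intertwiners\<close>

lemma mat_adjoint_dim [simp]:
  "dim_row (mat_adjoint A) = dim_col A" "dim_col (mat_adjoint A) = dim_row A"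
  by (simp_all add: mat_adjoint_def)

lemma mat_adjoint_carrier:
  "A \<in> carrier_mat r c \<Longrightarrow> mat_adjoint A \<in> carrier_mat c r"
  by auto

lemma mat_adjoint_index [simp]:
  "i < dim_col A \<Longrightarrow> j < dim_row A \<Longrightarrow> mat_adjoint A $$ (i, j) = conjugate (A $$ (j, i))"
  by (simp add: mat_adjoint_def mat_of_rows_index)

lemma mat_adjoint_adjoint [simp]: "mat_adjoint (mat_adjoint A) = A"
  by (intro eq_matI) auto

lemma mat_adjoint_mult:
  assumes "A \<in> carrier_mat r c" "B \<in> carrier_mat c d"
  shows "mat_adjoint (A * B) = mat_adjoint B * mat_adjoint (A :: complex mat)"
  using assms by (intro eq_matI) (auto simp: scalar_prod_def mult.commute)

text \<open>The Sylvester equation \<open>H R = R\<^sup>* H\<close> has only the zero solution on a block where the spectra of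
  \<open>R\<close> and \<open>R\<^sup>*\<close> are disjoint.\<close>

lemma upper_triangular_intertwiner_zero:
  fixes H R :: "complex mat"
  assumes H: "H \<in> carrier_mat m m" and R: "R \<in> carrier_mat m m" "upper_triangular R"
    and eq: "H * R = mat_adjoint R * H"
    and neq: "\<And>i j. i < k \<Longrightarrow> j < k \<Longrightarrow> R $$ (j, j) \<noteq> cnj (R $$ (i, i))"
    and k: "k \<le> m"
  shows "i < k \<Longrightarrow> j < k \<Longrightarrow> H $$ (i, j) = 0"
\<comment> \<open>In both products triangularity of \<open>R\<close> kills the terms with
  \<open>l\<close> beyond the diagonal index and the induction hypothesis kills those before it.
  Only the diagonal terms survive, and \<open>neq\<close> then forces the entry of \<open>H\<close>
  to vanish.\<close>
proof (induction "i + j" arbitrary: i j rule: less_induct)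
  case less
  have ij: "i < m" "j < m" using less.prems k by auto
  have "(H * R) $$ (i, j) = (\<Sum>l<m. H $$ (i, l) * R $$ (l, j))"
    using ij H R by (simp add: scalar_prod_def lessThan_atLeast0)
  also have "\<dots> = H $$ (i, j) * R $$ (j, j) + (\<Sum>l\<in>{..<m} - {j}. H $$ (i, l) * R $$ (l, j))"
    using ij by (intro sum.remove) auto
  also have "(\<Sum>l\<in>{..<m} - {j}. H $$ (i, l) * R $$ (l, j)) = 0"
  proof (intro sum.neutral ballI)
    fix l assume l: "l \<in> {..<m} - {j}"
    show "H $$ (i, l) * R $$ (l, j) = 0"
    proof (cases "l < j")
      case True
      then show ?thesis using less.hyps[of i l] less.prems by simp
    next
      case False
      then show ?thesis using l R(1) upper_triangularD[OF R(2), of j l] by auto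
    qed
  qed
  finally have L: "(H * R) $$ (i, j) = H $$ (i, j) * R $$ (j, j)" by simp
  have "(mat_adjoint R * H) $$ (i, j) = (\<Sum>l<m. cnj (R $$ (l, i)) * H $$ (l, j))"
    using ij H R by (simp add: scalar_prod_def lessThan_atLeast0)
  also have "\<dots> = cnj (R $$ (i, i)) * H $$ (i, j) + (\<Sum>l\<in>{..<m} - {i}. cnj (R $$ (l, i)) * H $$ (l, j))"
    using ij by (intro sum.remove) auto
  also have "(\<Sum>l\<in>{..<m} - {i}. cnj (R $$ (l, i)) * H $$ (l, j)) = 0"
  proof (intro sum.neutral ballI)
    fix l assume l: "l \<in> {..<m} - {i}"
    show "cnj (R $$ (l, i)) * H $$ (l, j) = 0"
    proof (cases "l < i")
      case True
      then show ?thesis using less.hyps[of l j] less.prems by simp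
    next
      case False
      then show ?thesis using l R(1) upper_triangularD[OF R(2), of i l] by auto
    qed
  qed
  finally have "(mat_adjoint R * H) $$ (i, j) = cnj (R $$ (i, i)) * H $$ (i, j)" by simp
  then have "H $$ (i, j) * R $$ (j, j) = H $$ (i, j) * cnj (R $$ (i, i))"
    using L eq by (metis mult.commute)
  then show ?case using neq[OF less.prems] mult_left_cancel by blast
qed

section \<open>Dimension bound for isotropic subspaces\<close>

text \<open>Padding the \<open>r\<close> equations with zero rows to a square system makes the
  determinant vanish, so the system has a nonzero solution.\<close>

lemma underdetermined_nontrivial_kernel:
  fixes f :: "nat \<Rightarrow> nat \<Rightarrow> 'a :: field"
  assumes "r < k"
  obtains a where "\<exists>j<k. a j \<noteq> 0" "\<And>i. i < r \<Longrightarrow> (\<Sum>j<k. f i j * a j) = 0"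
proof -
  define M where "M = mat k k (\<lambda>(i, j). if i < r then f i j else 0)"
  have M: "M \<in> carrier_mat k k" by (simp add: M_def)
  have z: "row M r = 0\<^sub>v k"
    using assms by (intro eq_vecI) (auto simp: M_def)
  \<comment> \<open>This is the shape in which \<open>det_row_0\<close> detects the zero row
    \<open>r\<close>, the first of the padding rows.\<close>
  have eq: "M = mat\<^sub>r k k (\<lambda>i. if i = r then 0\<^sub>v k else row M i)"
    using z assms by (intro eq_matI) (auto simp: M_def)
  have "row M \<in> {0..<k} \<rightarrow> carrier_vec k" using M by auto
  then have "det M = 0"
    by (rule trans[OF arg_cong[OF eq, of det] det_row_0[OF assms]])
  then obtain v where v: "v \<in> carrier_vec k" "v \<noteq> 0\<^sub>v k" "M *\<^sub>v v = 0\<^sub>v k"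
    using det_0_iff_vec_prod_zero_field[OF M] by auto
  show ?thesis
  proof
    show "\<exists>j<k. v $ j \<noteq> 0"
    proof (rule ccontr)
      assume "\<not> (\<exists>j<k. v $ j \<noteq> 0)"
      then have "v = 0\<^sub>v k" using v(1) by (intro eq_vecI) auto
      then show False using v(2) by simp
    qed
    fix i assume i: "i < r"
    have "0 = (M *\<^sub>v v) $ i" using i assms v(3) by simp
    also have "\<dots> = (\<Sum>j<k. f i j * v $ j)"
      using i assms v(1) by (simp add: M_def scalar_prod_def lessThan_atLeast0)
    finally show "(\<Sum>j<k. f i j * v $ j) = 0" by simp
  qed
qed

text \<open>If \<open>k\<close> exceeded \<open>r\<close>, some nontrivial combination of the first
  \<open>k\<close> columns of \<open>K\<close> would vanish in its first \<open>r\<close>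
  coordinates. On such vectors the diagonal form is definite, so isotropy makes the combination
  zero, against the invertibility of \<open>K\<close>.\<close>

lemma isotropic_block_bound:
  fixes K :: "complex mat" and d :: "nat \<Rightarrow> real"
  assumes K: "K \<in> carrier_mat m m" "det K \<noteq> 0"
    and definite: "(\<forall>i. r \<le> i \<and> i < m \<longrightarrow> d i > 0) \<or> (\<forall>i. r \<le> i \<and> i < m \<longrightarrow> d i < 0)"
    and isotropic: "\<And>i j. i < k \<Longrightarrow> j < k \<Longrightarrow>
      (\<Sum>l<m. cnj (K $$ (l, i)) * d l * K $$ (l, j)) = 0"
    and k: "k \<le> m"
  shows "k \<le> r"
proof (rule ccontr)
  assume "\<not> k \<le> r"
  then have "r < k" by simp
  then obtain a where a: "\<exists>j<k. a j \<noteq> 0" "\<And>i. i < r \<Longrightarrow> (\<Sum>j<k. K $$ (i, j) * a j) = 0"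
    by (rule underdetermined_nontrivial_kernel[where f = "\<lambda>i j. K $$ (i, j)"]) blast
  \<comment> \<open>These are the coordinates of the combination of columns; those below
    \<open>r\<close> vanish by the choice of \<open>a\<close>.\<close>
  define c where "c l = (\<Sum>j<k. K $$ (l, j) * a j)" for l
  have "(\<Sum>l<m. complex_of_real (d l * (cmod (c l))\<^sup>2)) = (\<Sum>l<m. cnj (c l) * d l * c l)"
    by (intro sum.cong refl) (simp add: complex_norm_square algebra_simps del: of_real_power)
  also have "\<dots> = (\<Sum>l<m. \<Sum>i<k. \<Sum>j<k. cnj (a j) * a i * (cnj (K $$ (l, j)) * d l * K $$ (l, i)))"
    unfolding c_def cnj_sum sum_distrib_right sum_distrib_left
    by (intro sum.cong refl) (simp add: algebra_simps)
  also have "\<dots> = (\<Sum>i<k. \<Sum>j<k. cnj (a j) * a i * (\<Sum>l<m. cnj (K $$ (l, j)) * d l * K $$ (l, i)))"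
    unfolding sum_distrib_left by (rule trans[OF sum.swap], rule sum.cong[OF refl], rule sum.swap)
  also have "\<dots> = 0" using isotropic by simp
  finally have sum0: "(\<Sum>l<m. d l * (cmod (c l))\<^sup>2) = 0"
    by (metis of_real_eq_0_iff of_real_sum)
  \<comment> \<open>A sign \<open>1\<close> or \<open>-1\<close> serves as \<open>t\<close>, so that
    the positive and the negative definite case are treated together.\<close>
  obtain t :: real where t: "\<And>i. r \<le> i \<Longrightarrow> i < m \<Longrightarrow> t * d i > 0"
    using definite by (metis mult_1 mult_minus1 neg_0_less_iff_less)
  have c0: "c l = 0" if "l < m" for l
  proof (cases "l < r")
    case True
    then show ?thesis using a(2) by (simp add: c_def)
  next
    case False
    have "t * (d l * (cmod (c l))\<^sup>2) = 0"
    proof (rule sum_nonneg_0[where f = "\<lambda>l. t * (d l * (cmod (c l))\<^sup>2)" and s = "{..<m}"])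
      show "(\<Sum>l<m. t * (d l * (cmod (c l))\<^sup>2)) = 0"
        using sum0 by (simp flip: sum_distrib_left)
      show "t * (d i * (cmod (c i))\<^sup>2) \<ge> 0" if "i \<in> {..<m}" for i
      proof (cases "i < r")
        case False
        then have "t * d i > 0" using t that by simp
        then show ?thesis by (simp flip: mult.assoc)
      qed (simp add: c_def a(2))
    qed (use that in simp_all)
    moreover have "t * d l > 0" using t that False by simp
    ultimately show ?thesis by auto
  qed
  \<comment> \<open>Padding \<open>a\<close> with zeros to length \<open>m\<close> turns the
    vanishing combination into a kernel vector of the whole matrix \<open>K\<close>.\<close>
  define v where "v = vec m (\<lambda>j. if j < k then a j else 0)"
  have "K *\<^sub>v v = 0\<^sub>v m"
  proof (intro eq_vecI)
    fix l assume "l < dim_vec (0\<^sub>v m :: complex vec)"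
    then have l: "l < m" by simp
    have "(K *\<^sub>v v) $ l = (\<Sum>j<m. K $$ (l, j) * (if j < k then a j else 0))"
      using l K by (simp add: v_def scalar_prod_def lessThan_atLeast0)
    also have "\<dots> = (\<Sum>j<k. K $$ (l, j) * a j)"
      using k by (intro sum.mono_neutral_cong_right) auto
    finally show "(K *\<^sub>v v) $ l = 0\<^sub>v m $ l" using c0[OF l] l by (simp add: c_def)
  qed (use K in auto)
  moreover have "v \<noteq> 0\<^sub>v m"
  proof
    assume "v = 0\<^sub>v m"
    obtain j where j: "j < k" "a j \<noteq> 0" using a(1) by blast
    then have "v $ j = 0" using \<open>v = 0\<^sub>v m\<close> k by simp
    then show False using j k by (simp add: v_def)
  qed
  moreover have "v \<in> carrier_vec m" by (simp add: v_def)
  ultimately show False using det_0_iff_vec_prod_zero_field[OF K(1)] K(2) by blast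
qed

section \<open>Spectral theorem for Hermitian matrices\<close>

text \<open>Gram-Schmidt applied to a basis starting with \<open>v\<close> keeps \<open>v\<close> in
  first place; normalizing the resulting orthogonal vectors gives the columns of \<open>U\<close>.
  The scalar \<open>c\<close> is the normalization factor.\<close>

lemma unitary_completion:
  fixes v :: "complex vec"
  assumes v: "v \<in> carrier_vec n" "v \<noteq> 0\<^sub>v n"
  obtains U c where "U \<in> carrier_mat n n" "mat_adjoint U * U = 1\<^sub>m n" "col U 0 = c \<cdot>\<^sub>v v"
proof -
  interpret cof_vec_space n "TYPE(complex)" .
  define ws where "ws = gram_schmidt n (basis_completion v)"
  note b = basis_completion[OF v]
  have n: "n \<noteq> 0" using v by auto
  have ws: "set ws \<subseteq> carrier_vec n" "corthogonal ws" "length ws = n"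
    using gram_schmidt_result[OF b(2,4,5) ws_def] b(6) by auto
  have hd: "hd ws = v"
    using gram_schmidt_hd[OF v(1), of "tl (basis_completion v)"] b(6,7) n
    by (cases "basis_completion v") (auto simp: ws_def)
  have ws0: "ws ! 0 = v" using hd ws(3) n by (cases ws) auto
  \<comment> \<open>The inner product has type \<open>complex\<close> but is a nonnegative real, so
    taking \<open>Re\<close> loses nothing.\<close>
  define nrm where "nrm i = sqrt (Re (ws ! i \<bullet>c ws ! i))" for i
  define U where "U = mat n n (\<lambda>(i, j). ws ! j $ i / complex_of_real (nrm j))"
  have U: "U \<in> carrier_mat n n" by (simp add: U_def)
  have wsc: "ws ! j \<in> carrier_vec n" if "j < n" for j using ws that by auto
  show ?thesis
  proof
    show "U \<in> carrier_mat n n" by fact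
    show "col U 0 = (1 / complex_of_real (nrm 0)) \<cdot>\<^sub>v v"
      using n ws0 v(1) by (intro eq_vecI) (auto simp: U_def)
    show "mat_adjoint U * U = 1\<^sub>m n"
    proof (intro eq_matI)
      fix i j assume "i < dim_row (1\<^sub>m n :: complex mat)" "j < dim_col (1\<^sub>m n :: complex mat)"
      then have ij: "i < n" "j < n" by auto
      have "(mat_adjoint U * U) $$ (i, j) = (ws ! j \<bullet>c ws ! i) / (nrm i * nrm j)"
        using ij wsc[of i] wsc[of j] U
        by (simp add: U_def scalar_prod_def sum_divide_distrib mult.commute)
      also have "\<dots> = 1\<^sub>m n $$ (i, j)"
      proof (cases "i = j")
        case False
        then show ?thesis using corthogonalD[OF ws(2), of j i] ij ws(3) by simp
      next
        case True
        have "ws ! i \<bullet>c ws ! i \<noteq> 0" using corthogonalD[OF ws(2), of i i] ij ws(3) by simp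
        moreover have "ws ! i \<bullet>c ws ! i \<ge> 0" by (rule conjugate_square_ge_0_vec)
        ultimately have "Re (ws ! i \<bullet>c ws ! i) > 0" "ws ! i \<bullet>c ws ! i = Re (ws ! i \<bullet>c ws ! i)"
          by (auto simp: less_eq_complex_def complex_eq_iff)
        then have "ws ! i \<bullet>c ws ! i = nrm i * nrm i" "nrm i \<noteq> 0"
          by (auto simp: nrm_def simp flip: of_real_mult)
        then show ?thesis using True ij by simp
      qed
      finally show "(mat_adjoint U * U) $$ (i, j) = 1\<^sub>m n $$ (i, j)" .
    qed (use U in auto)
  qed
qed

lemma block_diag_mult:
  fixes A A' D D' :: "'a :: semiring_1 mat"
  assumes "A \<in> carrier_mat r r" "A' \<in> carrier_mat r r" "D \<in> carrier_mat k k" "D' \<in> carrier_mat k k"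
  shows "four_block_mat A (0\<^sub>m r k) (0\<^sub>m k r) D * four_block_mat A' (0\<^sub>m r k) (0\<^sub>m k r) D' =
    four_block_mat (A * A') (0\<^sub>m r k) (0\<^sub>m k r) (D * D')"
  using assms by (subst mult_four_block_mat[of _ r r _ k _ k _ _ r _ k]) auto

text \<open>Deflation by induction on the list of roots: a unitary matrix whose first column is an
  eigenvector splits off one eigenvalue, and the remaining block is again Hermitian. The diagonal
  follows the order of \<open>es\<close>, which later allows a choice of which eigenvalues come
  first.\<close>

lemma unitary_diagonalization:
  fixes A :: "complex mat"
  assumes "A \<in> carrier_mat n n" "mat_adjoint A = A" "char_poly A = (\<Prod>e\<leftarrow>es. [:- e, 1:])"
  shows "\<exists>U. U \<in> carrier_mat n n \<and> mat_adjoint U * U = 1\<^sub>m n \<and>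
    mat_adjoint U * A * U = mat_diag n (\<lambda>i. es ! i)"
  using assms
proof (induction es arbitrary: n A)
  case Nil
  then have "n = 0" using degree_monic_char_poly[of A n] by simp
  then show ?case by (intro exI[of _ "1\<^sub>m 0"]) (auto simp: Nil mat_diag_def)
next
  case (Cons e es)
  note A = Cons.prems(1) and adjA = Cons.prems(2)
  have cp: "char_poly A = [:- e, 1:] * (\<Prod>e\<leftarrow>es. [:- e, 1:])" using Cons.prems(3) by simp
  have "eigenvalue A e"
    unfolding eigenvalue_root_char_poly[OF A] cp by simp
  then obtain v where v: "v \<in> carrier_vec n" "v \<noteq> 0\<^sub>v n" "A *\<^sub>v v = e \<cdot>\<^sub>v v"
    using A by (auto simp: eigenvalue_def eigenvector_def)
  then have "n \<noteq> 0" by auto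
  then obtain k where n: "n = Suc k" by (cases n) auto
  obtain U c where U: "U \<in> carrier_mat n n" "mat_adjoint U * U = 1\<^sub>m n" "col U 0 = c \<cdot>\<^sub>v v"
    using unitary_completion[OF v(1,2)] .
  have adjU: "mat_adjoint U \<in> carrier_mat n n" using U(1) by (rule mat_adjoint_carrier)
  have UU: "U * mat_adjoint U = 1\<^sub>m n"
    using mat_mult_left_right_inverse[OF adjU U(1) U(2)] .
  define A' where "A' = mat_adjoint U * A * U"
  have A': "A' \<in> carrier_mat n n" using U adjU A by (simp add: A'_def)
  have adjA': "mat_adjoint A' = A'"
    unfolding A'_def
    by (subst mat_adjoint_mult[OF mult_carrier_mat[OF adjU A] U(1)],
        subst mat_adjoint_mult[OF adjU A]) (use U adjU A adjA in simp)
  have "col (A * U) 0 = A *\<^sub>v (c \<cdot>\<^sub>v v)" using col_mult2[OF A U(1), of 0] n U(3) by simp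
  also have "\<dots> = c \<cdot>\<^sub>v (A *\<^sub>v v)" by (rule mult_mat_vec[OF A v(1)])
  also have "\<dots> = e \<cdot>\<^sub>v col U 0" unfolding v(3) U(3) by (simp add: smult_smult_assoc mult.commute)
  finally have colAU: "col (A * U) 0 = e \<cdot>\<^sub>v col U 0" .
  \<comment> \<open>The first column of \<open>U\<close> is an eigenvector and the columns are
    orthonormal, so the first column of \<open>A'\<close> is \<open>e\<close> times the first unit
    vector. Self-adjointness carries this over to the first row.\<close>
  have col0: "A' $$ (i, 0) = (if i = 0 then e else 0)" if i: "i < n" for i
  proof -
    have "A' = mat_adjoint U * (A * U)" using U adjU A by (simp add: A'_def)
    then have "A' $$ (i, 0) = row (mat_adjoint U) i \<bullet> col (A * U) 0"
      using i n U(1) A by simp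
    also have "\<dots> = e * (row (mat_adjoint U) i \<bullet> col U 0)"
      unfolding colAU using U(1) i
      by (intro scalar_prod_smult_distrib[of _ n] carrier_vecI) auto
    also have "row (mat_adjoint U) i \<bullet> col U 0 = (mat_adjoint U * U) $$ (i, 0)"
      using i n U(1) by simp
    finally show ?thesis using i n U(2) by simp
  qed
  have row0: "A' $$ (0, i) = (if i = 0 then e else 0)" if i: "i < n" for i
  proof (cases "i = 0")
    case False
    have "A' $$ (0, i) = mat_adjoint A' $$ (0, i)" using adjA' by simp
    also have "\<dots> = cnj (A' $$ (i, 0))" using i n A' by simp
    finally show ?thesis using col0[OF i] False by simp
  qed (use col0[of 0] n in simp)
  define A1 where "A1 = mat 1 1 (\<lambda>_. e)"
  define A3 where "A3 = mat k k (\<lambda>(i, j). A' $$ (Suc i, Suc j))"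
  have A1: "A1 \<in> carrier_mat 1 1" and A3: "A3 \<in> carrier_mat k k" by (simp_all add: A1_def A3_def)
  have block: "A' = four_block_mat A1 (0\<^sub>m 1 k) (0\<^sub>m k 1) A3"
    using A' n col0 row0 by (intro eq_matI) (auto simp: A1_def A3_def)
  \<comment> \<open>Similarity preserves the characteristic polynomial; cancelling the factor of
    \<open>e\<close> leaves the factorization needed for the block \<open>A3\<close>.\<close>
  have "similar_mat_wit A' A (mat_adjoint U) U"
    by (rule similar_mat_witI[OF U(2) UU A'_def A' A adjU U(1)])
  then have "similar_mat A' A" unfolding similar_mat_def by blast
  then have "char_poly A' = [:- e, 1:] * (\<Prod>e\<leftarrow>es. [:- e, 1:])"
    using char_poly_similar cp by metis
  moreover have "char_poly A' = char_poly A1 * char_poly A3"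
    unfolding block by (rule char_poly_four_block_zeros_col[OF A1 _ A3]) simp
  moreover have "char_poly A1 = [:- e, 1:]"
    by (simp add: A1_def char_poly_defs det_def sign_def)
  ultimately have cp3: "char_poly A3 = (\<Prod>e\<leftarrow>es. [:- e, 1:])"
    by (metis mult_cancel_left pCons_eq_0_iff zero_neq_one)
  have adjA3: "mat_adjoint A3 = A3"
  proof (intro eq_matI)
    fix i j assume "i < dim_row A3" "j < dim_col A3"
    then have ij: "i < k" "j < k" by (auto simp: A3_def)
    have "cnj (A' $$ (Suc j, Suc i)) = mat_adjoint A' $$ (Suc i, Suc j)" using ij n A' by simp
    then show "mat_adjoint A3 $$ (i, j) = A3 $$ (i, j)" using ij adjA' by (simp add: A3_def)
  qed (auto simp: A3_def)
  obtain V where V: "V \<in> carrier_mat k k" "mat_adjoint V * V = 1\<^sub>m k"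
    "mat_adjoint V * A3 * V = mat_diag k (\<lambda>i. es ! i)"
    using Cons.IH[OF A3 adjA3 cp3] by blast
  have adjV: "mat_adjoint V \<in> carrier_mat k k" using V(1) by (rule mat_adjoint_carrier)
  \<comment> \<open>\<open>P\<close> fixes the first unit vector and acts as \<open>V\<close> on the
    rest, so \<open>U * P\<close> diagonalizes \<open>A\<close>.\<close>
  define P where "P = four_block_mat (1\<^sub>m 1) (0\<^sub>m 1 k) (0\<^sub>m k 1) V"
  have P: "P \<in> carrier_mat n n"
    using four_block_carrier_mat[OF one_carrier_mat[of 1] V(1)] n by (simp add: P_def)
  have adjP: "mat_adjoint P = four_block_mat (1\<^sub>m 1) (0\<^sub>m 1 k) (0\<^sub>m k 1) (mat_adjoint V)"
    unfolding P_def using V(1) by (intro eq_matI) auto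
  have adjP': "mat_adjoint P \<in> carrier_mat n n" using P by (rule mat_adjoint_carrier)
  have "mat_adjoint P * P = four_block_mat (1\<^sub>m 1) (0\<^sub>m 1 k) (0\<^sub>m k 1) (1\<^sub>m k)"
    unfolding adjP unfolding P_def
    using block_diag_mult[OF one_carrier_mat one_carrier_mat adjV V(1), of 1] V(2) by simp
  then have PP: "mat_adjoint P * P = 1\<^sub>m n" using n by simp
  have "mat_adjoint P * A' = four_block_mat A1 (0\<^sub>m 1 k) (0\<^sub>m k 1) (mat_adjoint V * A3)"
    unfolding adjP block using block_diag_mult[OF one_carrier_mat A1 adjV A3] A1 by simp
  then have "mat_adjoint P * A' * P = four_block_mat A1 (0\<^sub>m 1 k) (0\<^sub>m k 1) (mat_adjoint V * A3 * V)"
    unfolding P_def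
    using block_diag_mult[OF A1 one_carrier_mat mult_carrier_mat[OF adjV A3] V(1)] A1 by simp
  then have PAP: "mat_adjoint P * A' * P = mat_diag n (\<lambda>i. (e # es) ! i)"
    unfolding V(3) using n by (auto intro!: eq_matI simp: mat_diag_def A1_def nth_Cons')
  have "mat_adjoint (U * P) * (U * P) = mat_adjoint P * ((mat_adjoint U * U) * P)"
    using U(1) adjU P adjP' by (simp add: mat_adjoint_mult[OF U(1) P] assoc_mult_mat[of _ n n _ n _ n])
  then have 1: "mat_adjoint (U * P) * (U * P) = 1\<^sub>m n" using PP U(2) P by simp
  have "mat_adjoint (U * P) * A * (U * P) = mat_adjoint P * A' * P"
    using U(1) adjU P adjP' A by (simp add: mat_adjoint_mult[OF U(1) P] A'_def assoc_mult_mat[of _ n n _ n _ n])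
  then have 2: "mat_adjoint (U * P) * A * (U * P) = mat_diag n (\<lambda>i. (e # es) ! i)" using PAP by simp
  show ?case using 1 2 U(1) P by (intro exI[of _ "U * P"]) auto
qed

section \<open>Eigenvalue counts and real spectra\<close>

lemma order_prod_linear_factors:
  "Polynomial.order x (\<Prod>a\<leftarrow>as. [:- a, 1:]) = count_list as (x :: 'a :: field)"
proof (induction as)
  case (Cons a as)
  have "(\<Prod>a\<leftarrow>as. [:- a, 1:]) \<noteq> 0" by auto
  then have "[:- a, 1:] * (\<Prod>a\<leftarrow>as. [:- a, 1:]) \<noteq> 0" by (simp del: mult_pCons_left)
  then show ?case using Cons by (simp add: order_mult order_linear' del: mult_pCons_left)
qed simp

text \<open>Once the characteristic polynomial splits, multiplicities become repetitions in the list
  of roots, so the weighted count turns into a list length.\<close>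

lemma eigenvalue_count_factorized:
  assumes A: "A \<in> carrier_mat n n" and cp: "char_poly A = (\<Prod>a\<leftarrow>as. [:- a, 1:])"
  shows "eigenvalue_count P A = length (filter P as)"
proof -
  have "{a. eigenvalue A a \<and> P a} = set (filter P as)"
    unfolding eigenvalue_root_char_poly[OF A] cp
    by (auto simp: poly_prod_list)
  then have "eigenvalue_count P A = (\<Sum>a\<in>set (filter P as). count_list as a)"
    by (simp add: eigenvalue_count_def cp order_prod_linear_factors)
  also have "\<dots> = (\<Sum>a\<in>set (filter P as). count_list (filter P as) a)"
  proof (intro sum.cong refl)
    fix a assume "a \<in> set (filter P as)"
    then have "P a" by simp
    then show "count_list as a = count_list (filter P as) a" by (induction as) auto
  qed
  also have "\<dots> = length (filter P as)" by (rule sum_count_set) auto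
  finally show ?thesis .
qed

text \<open>Unitary conjugation keeps \<open>A\<close> self-adjoint, so the diagonal form equals its
  own adjoint and its entries are real.\<close>

lemma hermitian_char_poly_roots_real:
  fixes A :: "complex mat"
  assumes "A \<in> carrier_mat n n" "mat_adjoint A = A" "char_poly A = (\<Prod>e\<leftarrow>es. [:- e, 1:])"
    and e: "e \<in> set es"
  shows "e \<in> \<real>"
proof -
  obtain U where U: "U \<in> carrier_mat n n" "mat_adjoint U * A * U = mat_diag n (\<lambda>i. es ! i)"
    using unitary_diagonalization[OF assms(1-3)] by blast
  have adjU: "mat_adjoint U \<in> carrier_mat n n" using U(1) by (rule mat_adjoint_carrier)
  have "length es = n"
    using degree_monic_char_poly[OF assms(1)] assms(3) by (simp add: degree_linear_factors)
  then obtain i where i: "i < n" "e = es ! i" using e by (metis in_set_conv_nth)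
  have "mat_adjoint (mat_adjoint U * A * U) = mat_adjoint U * A * U"
    by (subst mat_adjoint_mult[OF mult_carrier_mat[OF adjU assms(1)] U(1)],
        subst mat_adjoint_mult[OF adjU assms(1)]) (use U(1) adjU assms in simp)
  then have "mat_adjoint (mat_diag n (\<lambda>i. es ! i)) $$ (i, i) = mat_diag n (\<lambda>i. es ! i) $$ (i, i)"
    unfolding U(2) by simp
  then have "cnj e = e" using i by (simp add: mat_diag_def)
  then show ?thesis by (simp add: Reals_cnj_iff)
qed

section \<open>Bound for a part of the spectrum without conjugate pairs\<close>

text \<open>The leading \<open>length es\<close> columns of a triangularizing basis of
  \<open>C\<close> are isotropic for the form of \<open>A\<close>, while that form is definite on
  the span of the eigenvectors belonging to \<open>cs\<close>. The case \<open>a = b\<close> of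
  \<open>nonconj\<close> excludes real values from \<open>es\<close>.\<close>

lemma neutral_spectrum_bound:
  fixes A C :: "complex mat"
  assumes A: "A \<in> carrier_mat m m" "mat_adjoint A = A"
    and C: "C \<in> carrier_mat m m" "mat_adjoint (A * C) = A * C"
    and cpA: "char_poly A = (\<Prod>a\<leftarrow>bs @ cs. [:- a, 1:])"
    and definite: "(\<forall>c\<in>set cs. Re c > 0) \<or> (\<forall>c\<in>set cs. Re c < 0)"
    and cpC: "char_poly C = (\<Prod>a\<leftarrow>es @ fs. [:- a, 1:])"
    and nonconj: "\<And>a b. a \<in> set es \<Longrightarrow> b \<in> set es \<Longrightarrow> b \<noteq> cnj a"
  shows "length es \<le> length bs"
proof -
  have lenA: "length (bs @ cs) = m"
    using degree_monic_char_poly[OF A(1)] cpA degree_linear_factors[of uminus "bs @ cs"] by simp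
  have lenC: "length (es @ fs) = m"
    using degree_monic_char_poly[OF C(1)] cpC degree_linear_factors[of uminus "es @ fs"] by simp
  note assoc = assoc_mult_mat[of _ m m _ m _ m]
  \<comment> \<open>The Schur decomposition puts the eigenvalues on the diagonal of \<open>R\<close>
    in the order of the given list, hence those of \<open>es\<close> first.\<close>
  obtain R P Q where schur: "schur_decomposition C (es @ fs) = (R, P, Q)"
    by (cases "schur_decomposition C (es @ fs)") auto
  from schur_decomposition[OF C(1) cpC schur]
  have sim: "similar_mat_wit C R P Q" and ut: "upper_triangular R" and diag: "diag_mat R = es @ fs"
    by auto
  from similar_mat_witD2[OF C(1) sim]
  have R: "R \<in> carrier_mat m m" and P: "P \<in> carrier_mat m m" and Q: "Q \<in> carrier_mat m m"
    and PQ: "P * Q = 1\<^sub>m m" and QP: "Q * P = 1\<^sub>m m" and CPRQ: "C = P * R * Q" by auto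
  have CP: "C * P = P * R" unfolding CPRQ using R P Q QP by (simp add: assoc)
  have Rjj: "R $$ (j, j) \<in> set es" if "j < length es" for j
  proof -
    have "R $$ (j, j) = diag_mat R ! j" using that R lenC by (simp add: diag_mat_def)
    then show ?thesis using that by (simp add: diag nth_append)
  qed
  have aP: "mat_adjoint P \<in> carrier_mat m m" and aR: "mat_adjoint R \<in> carrier_mat m m"
    and aC: "mat_adjoint C \<in> carrier_mat m m"
    using P R C(1) by (auto intro: mat_adjoint_carrier)
  \<comment> \<open>The Gram matrix of the form of \<open>A\<close> on the columns of
    \<open>P\<close>. Self-adjointness of \<open>A\<close> and \<open>A * C\<close> makes it
    intertwine \<open>R\<close> with its adjoint.\<close>
  define H where "H = mat_adjoint P * (A * P)"
  have H: "H \<in> carrier_mat m m" using aP A P by (simp add: H_def)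
  have "mat_adjoint R * H = mat_adjoint (C * P) * (A * P)"
    unfolding H_def CP mat_adjoint_mult[OF P R] using aR aP A(1) P by (simp add: assoc)
  also have "\<dots> = mat_adjoint P * (mat_adjoint C * A * P)"
    unfolding mat_adjoint_mult[OF C(1) P] using aC aP A(1) P by (simp add: assoc)
  also have "mat_adjoint C * A = A * C"
    using C(2) mat_adjoint_mult[OF A(1) C(1)] A(2) by simp
  also have "mat_adjoint P * (A * C * P) = H * R"
    unfolding H_def using aP A(1) C(1) P R CP by (simp add: assoc)
  finally have HR: "H * R = mat_adjoint R * H" by simp
  have H0: "H $$ (i, j) = 0" if "i < length es" "j < length es" for i j
    by (rule upper_triangular_intertwiner_zero[OF H R ut HR _ _ that])
       (use nonconj Rjj lenC in auto)

  obtain U where U: "U \<in> carrier_mat m m" "mat_adjoint U * U = 1\<^sub>m m"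
    "mat_adjoint U * A * U = mat_diag m (\<lambda>i. (bs @ cs) ! i)"
    using unitary_diagonalization[OF A cpA] by blast
  have aU: "mat_adjoint U \<in> carrier_mat m m" using U(1) by (rule mat_adjoint_carrier)
  have UU: "U * mat_adjoint U = 1\<^sub>m m" using mat_mult_left_right_inverse[OF aU U(1,2)] .
  \<comment> \<open>The columns of \<open>P\<close> in coordinates of the orthonormal eigenbasis of
    \<open>A\<close>; there the form becomes diagonal.\<close>
  define K where "K = mat_adjoint U * P"
  have K: "K \<in> carrier_mat m m" using aU P by (simp add: K_def)
  have "K * (Q * U) = mat_adjoint U * ((P * Q) * U)"
    unfolding K_def using aU P Q U(1) by (simp add: assoc)
  then have "K * (Q * U) = 1\<^sub>m m" using PQ U by simp
  then have detK: "det K \<noteq> 0"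
    using det_mult[OF K mult_carrier_mat[OF Q U(1)]] by auto
  define d where "d l = Re ((bs @ cs) ! l)" for l
  have d: "(bs @ cs) ! l = complex_of_real (d l)" if "l < m" for l
    using hermitian_char_poly_roots_real[OF A cpA, of "(bs @ cs) ! l"] that lenA
    by (simp add: d_def of_real_Re del: length_append set_append)
  have aK: "mat_adjoint K = mat_adjoint P * U"
    unfolding K_def mat_adjoint_mult[OF aU P] by simp
  \<comment> \<open>The identity \<open>U * mat_adjoint U\<close> is inserted on both sides of
    \<open>A\<close> to bring in its diagonal form.\<close>
  have "H = mat_adjoint P * ((U * mat_adjoint U) * (A * ((U * mat_adjoint U) * P)))"
    unfolding UU H_def using A(1) P by (simp add: assoc)
  also have "\<dots> = mat_adjoint K * ((mat_adjoint U * A * U) * K)"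
    unfolding aK unfolding K_def using aP aU U(1) A(1) P by (simp add: assoc)
  finally have HK: "H = mat_adjoint K * (mat_diag m (\<lambda>i. (bs @ cs) ! i) * K)" unfolding U(3) .
  have sumH: "(\<Sum>l<m. cnj (K $$ (l, i)) * d l * K $$ (l, j)) = H $$ (i, j)" if "i < m" "j < m" for i j
    unfolding HK mat_diag_mult_left[OF K] using that K d
    by (auto simp: scalar_prod_def lessThan_atLeast0 mult.assoc intro!: sum.cong)
  show ?thesis
  proof (rule isotropic_block_bound[OF K detK])
    show "(\<forall>i. length bs \<le> i \<and> i < m \<longrightarrow> d i > 0) \<or> (\<forall>i. length bs \<le> i \<and> i < m \<longrightarrow> d i < 0)"
      using definite lenA by (force simp: d_def nth_append)
    show "(\<Sum>l<m. cnj (K $$ (l, i)) * d l * K $$ (l, j)) = 0"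
      if "i < length es" "j < length es" for i j
      using that lenC sumH[of i j] H0[of i j] by simp
    show "length es \<le> m" using lenC by simp
  qed
qed

section \<open>Passage to the inertia of the real matrix\<close>

lemma prod_list_map_partition:
  fixes f :: "'a \<Rightarrow> 'b :: comm_monoid_mult"
  shows "prod_list (map f (filter P xs)) * prod_list (map f (filter (\<lambda>x. \<not> P x) xs)) =
    prod_list (map f xs)"
  by (induction xs) (auto simp: ac_simps)

theorem proposition1p4:
  fixes B T W :: "real mat" and m s p n :: nat
  assumes "B \<in> carrier_mat m m" and "T \<in> carrier_mat m m" and "W \<in> carrier_mat m m"
    and "invertible_mat B"
    and "B = T * W"
    and "transpose_mat T = T"
    and "transpose_mat W = W"
    and "inertia T = (p, n, 0)"
    and "s \<le> m"
    and "eigenvalue_count (\<lambda>z. Im z \<noteq> 0) (map_mat complex_of_real B) = m - s"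
  shows "real m / 2 - real s / 2 \<le> real p \<and> real p \<le> real m / 2 + real s / 2"
proof -
  let ?c = "map_mat complex_of_real"
  let ?A = "?c T" and ?C = "?c W * ?c T"
  note T = assms(2) and W = assms(3)
  have A: "?A \<in> carrier_mat m m" and Wc: "?c W \<in> carrier_mat m m" and C: "?C \<in> carrier_mat m m"
    using T W by auto
  have adj: "mat_adjoint (?c X) = ?c (transpose_mat X)" for X :: "real mat"
    by (intro eq_matI) auto
  have adjA: "mat_adjoint ?A = ?A" and adjW: "mat_adjoint (?c W) = ?c W"
    using adj assms(6,7) by auto
  have adjAC: "mat_adjoint (?A * ?C) = ?A * ?C"
    using A Wc C adjA adjW by (simp add: mat_adjoint_mult[OF A C] mat_adjoint_mult[OF Wc A])
  obtain as where as: "char_poly ?A = (\<Prod>a\<leftarrow>as. [:- a, 1:])" "length as = m"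
    using char_poly_factorized[OF A] by auto
  obtain ls where ls: "char_poly (?c B) = (\<Prod>a\<leftarrow>ls. [:- a, 1:])"
    using char_poly_factorized[of "?c B" m] assms(1) by auto
  have "transpose_mat B = W * T"
    using transpose_mult[OF T W] assms(5-7) by simp
  then have "transpose_mat (?c B) = ?C"
    using of_real_hom.mat_hom_mult[OF W T, where 'a = complex] by (simp add: map_mat_transpose)
  then have cpC: "char_poly ?C = (\<Prod>a\<leftarrow>ls. [:- a, 1:])"
    using ls char_poly_transpose_mat[of "?c B" m] assms(1) by simp

  \<comment> \<open>The complex roots for \<open>T\<close> are real, so \<open>char_poly T\<close>
    already splits over the reals with roots \<open>rs\<close>. This links \<open>inertia\<close>,
    which counts real eigenvalues, to the list \<open>as\<close>.\<close>
  define rs where "rs = map Re as"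
  have as_rs: "as = map complex_of_real rs"
    unfolding rs_def map_map
    by (rule map_idI[symmetric]) (use hermitian_char_poly_roots_real[OF A adjA as(1)] in simp)
  interpret poly_of_real: map_poly_inj_idom_hom complex_of_real ..
  have "map_poly complex_of_real (\<Prod>a\<leftarrow>rs. [:- a, 1:]) = (\<Prod>a\<leftarrow>rs. [:- complex_of_real a, 1:])"
    by (induction rs) (simp_all add: poly_of_real.hom_mult hom_distribs del: mult_pCons_left)
  then have "map_poly complex_of_real (char_poly T) = map_poly complex_of_real (\<Prod>a\<leftarrow>rs. [:- a, 1:])"
    using as(1) of_real_hom.char_poly_hom[OF T, where 'a = complex]
    by (simp add: as_rs o_def)
  then have cpT: "char_poly T = (\<Prod>a\<leftarrow>rs. [:- a, 1:])" by simp
  have count: "eigenvalue_count S T = length (filter (\<lambda>a. S (Re a)) as)" for S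
    unfolding eigenvalue_count_factorized[OF T cpT] by (simp add: as_rs filter_map o_def)
  have p: "p = length (filter (\<lambda>a. Re a > 0) as)" and z: "length (filter (\<lambda>a. Re a = 0) as) = 0"
    using assms(8) by (auto simp: inertia_def count)
  have notpos: "length (filter (\<lambda>a. \<not> Re a > 0) as) = m - p"
    using sum_length_filter_compl[of "\<lambda>a. Re a > 0" as] p as(2) by simp
  \<comment> \<open>Here the zero in the inertia enters: nonnegative eigenvalues are
    positive.\<close>
  have "filter (\<lambda>a. \<not> Re a < 0) as = filter (\<lambda>a. Re a > 0) as"
    using z by (intro filter_cong refl) (auto simp: filter_empty_conv)
  then have notneg: "length (filter (\<lambda>a. \<not> Re a < 0) as) = p" using p by simp
  have "p \<le> m" using p as(2) length_filter_le by blast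

  \<comment> \<open>\<open>S\<close> selects eigenvalues of \<open>B\<close> without conjugate
    pairs, and \<open>D\<close> selects the eigenvalues of \<open>T\<close> on which the form is
    definite. Both root lists are reordered accordingly; the two choices of \<open>D\<close> give
    the bounds \<open>m - p\<close> and \<open>p\<close>.\<close>
  have bound: "length (filter S ls) \<le> length (filter (\<lambda>a. \<not> D a) as)"
    if S: "\<And>a b. S a \<Longrightarrow> S b \<Longrightarrow> b \<noteq> cnj a" and D: "D = (\<lambda>a. Re a > 0) \<or> D = (\<lambda>a. Re a < 0)" for S D
  proof (rule neutral_spectrum_bound[OF A adjA C adjAC])
    show "char_poly ?A = (\<Prod>a\<leftarrow>filter (\<lambda>a. \<not> D a) as @ filter D as. [:- a, 1:])"
      using as(1) prod_list_map_partition[of "\<lambda>a. [:- a, 1:]" D as] by (simp add: mult.commute)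
    show "char_poly ?C = (\<Prod>a\<leftarrow>filter S ls @ filter (\<lambda>a. \<not> S a) ls. [:- a, 1:])"
      using cpC prod_list_map_partition[of "\<lambda>a. [:- a, 1:]" S ls] by simp
  qed (use S D in auto)
  have upper: "length (filter (\<lambda>z. Im z > 0) ls) \<le> p" "length (filter (\<lambda>z. Im z > 0) ls) \<le> m - p"
    using bound[of "\<lambda>z. Im z > 0" "\<lambda>a. Re a < 0"] bound[of "\<lambda>z. Im z > 0" "\<lambda>a. Re a > 0"]
      notpos notneg by (force simp: complex_eq_iff)+
  have lower: "length (filter (\<lambda>z. Im z < 0) ls) \<le> p" "length (filter (\<lambda>z. Im z < 0) ls) \<le> m - p"
    using bound[of "\<lambda>z. Im z < 0" "\<lambda>a. Re a < 0"] bound[of "\<lambda>z. Im z < 0" "\<lambda>a. Re a > 0"]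
      notpos notneg by (force simp: complex_eq_iff)+
  have "m - s = length (filter (\<lambda>z. Im z \<noteq> 0) ls)"
    using assms(10) eigenvalue_count_factorized[OF _ ls] assms(1) by simp
  also have "\<dots> = length (filter (\<lambda>z. Im z > 0) ls) + length (filter (\<lambda>z. Im z < 0) ls)"
    by (induction ls) auto
  finally have "m - s \<le> 2 * p" "m - s \<le> 2 * (m - p)" using upper lower by simp_all
  \<comment> \<open>The subtractions are on natural numbers; \<open>s \<le> m\<close> and
    \<open>p \<le> m\<close> make them agree with the real ones.\<close>
  then show ?thesis using \<open>s \<le> m\<close> \<open>p \<le> m\<close> by (simp add: field_simps) linarith
qed

end
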